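(* Let $k,\ell,m>0$ be integers and set $s=k+\ell+m$. The number $V_{k,\ell,m}=V(1^k2^\ell3^m)$ of vertices of the Gelfand--Zetlin polytope $GZ(1^k2^\ell3^m)$ is given by $$V_{k,\ell,m}=\binom{s}{k}\binom{s}{m}+2\sum_{i=1}^{k}(-1)^i\binom{s}{k-i}\binom{s}{m-i}.$$
   Context: Let $\lambda_1\le\dots\le\lambda_n$ be a non-decreasing finite sequence of integers (called a partition). The Gelfand--Zetlin polytope $GZ(\lambda)$ is the convex polytope in $\mathbb{R}^{n(n-1)/2}$ with coordinates $u_{i,j}$ ($1\le i\le n-1$, $1\le j\le n-i$) defined by the inequalities $u_{i-1,j}\le u_{i,j}\le u_{i-1,j+1}$ for all such $i,j$, where $u_{0,j}:=\lambda_j$. $1^k2^\ell3^m$ denotes the sequence consisting of $k$ copies of $1$, followed by $\ell$ copies of $2$, followed by $m$ copies of $3$. $V(p)$ denotes the number of vertices of $GZ(p)$. Binomial coefficients $\binom{s}{j}$ with $j<0$ are $0$. *)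

theory Defs
  imports "HOL-Analysis.Analysis" "HOL-Library.Function_Algebras"
begin

text \<open>
  The ambient dimension of a Gelfand--Zetlin polytope depends on the length of the partition, so
  its points are functions on index pairs, with the pointwise vector space structure, that vanish
  outside the finite index set. This makes the library's \<open>extreme_point_of\<close> applicable.
\<close>

instantiation "fun" :: (type, real_vector) real_vector
begin

definition scaleR_fun_def: "scaleR c f = (\<lambda>x. c *\<^sub>R f x)"

instance
  by standard
     (simp_all add: scaleR_fun_def fun_eq_iff plus_fun_def scaleR_add_right scaleR_add_left)

end

definition gz_index :: "nat \<Rightarrow> (nat \<times> nat) set" where
  "gz_index n = {(i, j). 1 \<le> i \<and> i \<le> n - 1 \<and> 1 \<le> j \<and> j \<le> n - i}"

text \<open>Row \<open>0\<close> of the array is the partition; lists are indexed from \<open>0\<close>, the array columns from \<open>1\<close>.\<close>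

definition gz_entry :: "int list \<Rightarrow> (nat \<times> nat \<Rightarrow> real) \<Rightarrow> nat \<Rightarrow> nat \<Rightarrow> real" where
  "gz_entry p u i j = (if i = 0 then of_int (p ! (j - 1)) else u (i, j))"

definition GZ :: "int list \<Rightarrow> (nat \<times> nat \<Rightarrow> real) set" where
  "GZ p = {u. (\<forall>x. x \<notin> gz_index (length p) \<longrightarrow> u x = 0) \<and>
              (\<forall>(i, j) \<in> gz_index (length p).
                 gz_entry p u (i - 1) j \<le> gz_entry p u i j \<and>
                 gz_entry p u i j \<le> gz_entry p u (i - 1) (j + 1))}"

definition num_vertices :: "int list \<Rightarrow> nat" where
  "num_vertices p = card {v. v extreme_point_of GZ p}"

definition partition123 :: "nat \<Rightarrow> nat \<Rightarrow> nat \<Rightarrow> int list" where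
  "partition123 k l m = replicate k 1 @ replicate l 2 @ replicate m 3"

text \<open>Binomial coefficient with the convention that it is \<open>0\<close> for a negative lower index.\<close>

definition zbinomial :: "nat \<Rightarrow> int \<Rightarrow> int" where
  "zbinomial s j = (if j < 0 then 0 else int (s choose nat j))"

end

theory Submission
  imports Defs
begin

text \<open>
  If some entry of a point of \<open>GZ p\<close> is not a part of \<open>p\<close>, then moving all entries with that value
  simultaneously up or down by a small amount stays inside the polytope; so all entries of a vertex
  are parts of \<open>p\<close>, and each entry of its first row equals one of its two upper neighbours.
  Conversely, a first row \<open>q\<close> of this kind cuts out a face isomorphic to \<open>GZ q\<close>. Hence \<open>V(p)\<close> is the
  sum of \<open>V(q)\<close> over the distinct such rows \<open>q\<close>, and for three values
  \<open>V(k,l,m) = V(k,l,m-1) + V(k,l-1,m) + V(k-1,l+1,m-1) + V(k-1,l,m)\<close>.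
  The right-hand side of the claim is the coefficient of \<open>x^k y^m\<close> in
  \<open>(1 + x)^s (1 + y)^s (1 - x y) / (1 + x y)\<close>; the factor \<open>(1 + x)(1 + y)\<close> gained from \<open>s - 1\<close> to \<open>s\<close>
  is the same recurrence.
\<close>

section \<open>The defining inequalities and the entries of extreme points\<close>

lemma gz_index_iff: "(i, j) \<in> gz_index n \<longleftrightarrow> 1 \<le> i \<and> 1 \<le> j \<and> i + j \<le> n"
  by (auto simp: gz_index_def)

lemma finite_gz_index: "finite (gz_index n)"
  by (rule finite_subset[of _ "{..n} \<times> {..n}"]) (auto simp: gz_index_def)

text \<open>Shifting the row index removes the subtraction \<open>i - 1\<close>. Only the upper of
  two adjacent rows can be row \<open>0\<close>, so \<open>gz_entry\<close> survives there
  alone.\<close>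

lemma GZ_iff:
  "u \<in> GZ p \<longleftrightarrow> (\<forall>x. x \<notin> gz_index (length p) \<longrightarrow> u x = 0) \<and>
     (\<forall>i j. 1 \<le> j \<longrightarrow> Suc i + j \<le> length p \<longrightarrow>
        gz_entry p u i j \<le> u (Suc i, j) \<and> u (Suc i, j) \<le> gz_entry p u i (Suc j))"
proof -
  have "(\<forall>(i, j) \<in> gz_index (length p).
           gz_entry p u (i - 1) j \<le> gz_entry p u i j \<and>
           gz_entry p u i j \<le> gz_entry p u (i - 1) (j + 1)) \<longleftrightarrow>
        (\<forall>i j. 1 \<le> j \<longrightarrow> Suc i + j \<le> length p \<longrightarrow>
           gz_entry p u i j \<le> u (Suc i, j) \<and> u (Suc i, j) \<le> gz_entry p u i (Suc j))" (is "?A \<longleftrightarrow> ?B")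
  proof
    assume A: ?A
    show ?B
    proof (intro allI impI)
      fix i j assume "1 \<le> j" "Suc i + j \<le> length p"
      then have "(Suc i, j) \<in> gz_index (length p)" by (simp add: gz_index_iff)
      from bspec[OF A this]
      have "gz_entry p u i j \<le> gz_entry p u (Suc i) j \<and>
          gz_entry p u (Suc i) j \<le> gz_entry p u i (Suc j)"
        by simp
      then show "gz_entry p u i j \<le> u (Suc i, j) \<and> u (Suc i, j) \<le> gz_entry p u i (Suc j)"
        by (simp add: gz_entry_def[of p u "Suc i"])
    qed
  next
    assume B: ?B
    show ?A
    proof (intro ballI, clarify)
      fix i j assume "(i, j) \<in> gz_index (length p)"
      then obtain i' where "i = Suc i'" "1 \<le> j" "Suc i' + j \<le> length p"
        by (cases i) (auto simp: gz_index_iff)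
      with B show "gz_entry p u (i - 1) j \<le> gz_entry p u i j \<and>
           gz_entry p u i j \<le> gz_entry p u (i - 1) (j + 1)"
        by (simp add: gz_entry_def)
    qed
  qed
  then show ?thesis by (simp add: GZ_def)
qed

lemma extreme_point_of_GZ_entry:
  assumes "u extreme_point_of GZ p" "x \<in> gz_index (length p)"
  shows "u x \<in> of_int ` set p"
proof (rule ccontr)
  assume c: "u x \<notin> of_int ` set p"
  define c where "c = u x"
  have uG: "u \<in> GZ p" using assms(1) by (simp add: extreme_point_of_def)
  define W where "W = (\<lambda>(i, j). gz_entry p u i j) ` {(i, j). 1 \<le> j \<and> i + j \<le> length p}"
  have "finite {(i, j). 1 \<le> j \<and> i + j \<le> length p}"
    by (rule finite_subset[of _ "{..length p} \<times> {..length p}"]) auto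
  then have finW: "finite W" by (simp add: W_def)
  \<comment> \<open>\<open>e\<close> is the least distance from \<open>c\<close> to another value in
    the array, row \<open>0\<close> included, capped at \<open>1\<close> so that \<open>Min\<close>
    is taken over a nonempty set.\<close>
  define e where "e = Min (insert 1 ((\<lambda>v. \<bar>v - c\<bar>) ` (W - {c})))"
  have e0: "e > 0" using finW by (auto simp: e_def)
  have eW: "e \<le> \<bar>v - c\<bar>" if "v \<in> W" "v \<noteq> c" for v
    unfolding e_def using finW that by (intro Min_le) auto
  have inW: "gz_entry p u i j \<in> W" if "1 \<le> j" "i + j \<le> length p" for i j
    unfolding W_def using that by force
  define d where "d t = (\<lambda>z. if z \<in> gz_index (length p) \<and> u z = c then t else (0::real))" for t
  \<comment> \<open>No part equals \<open>c\<close>, so row \<open>0\<close> stays put and one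
    formula describes all rows.\<close>
  have entry: "gz_entry p (u + d t) i j = gz_entry p u i j + (if gz_entry p u i j = c then t else 0)"
    if "1 \<le> j" "i + j \<le> length p" for t i j
  proof (cases "i = 0")
    case True
    have "p ! (j - 1) \<in> set p" using that by simp
    then have "real_of_int (p ! (j - 1)) \<noteq> c" using c by (metis c_def imageI)
    then show ?thesis using True by (simp add: gz_entry_def)
  next
    case False
    then show ?thesis using that by (simp add: gz_entry_def d_def gz_index_iff)
  qed
  \<comment> \<open>Equal values move together. If exactly one of \<open>v\<close> and
    \<open>w\<close> equals \<open>c\<close>, their gap is at least \<open>e\<close>, so the order
    survives.\<close>
  have mono: "v + (if v = c then t else 0) \<le> w + (if w = c then t else 0)"
    if "v \<in> W" "w \<in> W" "v \<le> w" "\<bar>t\<bar> \<le> e" for v w t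
    using eW[OF that(1)] eW[OF that(2)] that(3,4) by auto
  have G: "u + d t \<in> GZ p" if t: "\<bar>t\<bar> \<le> e" for t
    unfolding GZ_iff
  proof (intro conjI allI impI)
    fix x assume "x \<notin> gz_index (length p)"
    then show "(u + d t) x = 0" using uG[unfolded GZ_iff] by (simp add: d_def del: split_paired_All)
  next
    fix i j assume ij: "1 \<le> j" "Suc i + j \<le> length p"
    have E: "gz_entry p w (Suc i) j = w (Suc i, j)" for w by (simp add: gz_entry_def)
    have le: "gz_entry p u i j \<le> gz_entry p u (Suc i) j" "gz_entry p u (Suc i) j \<le> gz_entry p u i (Suc j)"
      using uG ij by (simp_all add: GZ_iff E)
    have bnd: "i + j \<le> length p" "1 \<le> Suc j" "i + Suc j \<le> length p" using ij by simp_all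
    show "gz_entry p (u + d t) i j \<le> (u + d t) (Suc i, j)"
      unfolding E[symmetric] entry[OF ij] entry[OF ij(1) bnd(1)]
      by (rule mono[OF inW[OF ij(1) bnd(1)] inW[OF ij] le(1) t])
    show "(u + d t) (Suc i, j) \<le> gz_entry p (u + d t) i (Suc j)"
      unfolding E[symmetric] entry[OF ij] entry[OF bnd(2,3)]
      by (rule mono[OF inW[OF ij] inW[OF bnd(2,3)] le(2) t])
  qed
  have "d e x \<noteq> d (- e) x" using assms(2) e0 by (simp add: d_def c_def)
  then have ne: "u + d e \<noteq> u + d (- e)" by (metis add_left_cancel)
  have "u = (1 - 1/2) *\<^sub>R (u + d e) + (1/2) *\<^sub>R (u + d (- e))"
    by (auto simp: fun_eq_iff scaleR_fun_def d_def field_simps)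
  then have "u \<in> open_segment (u + d e) (u + d (- e))"
    unfolding in_segment using ne by (intro conjI exI[of _ "1/2"]) auto
  moreover have "u + d e \<in> GZ p" "u + d (- e) \<in> GZ p" using G e0 by auto
  ultimately show False using assms(1) by (auto simp: extreme_point_of_def)
qed

text \<open>\<open>num_vertices\<close> is a \<open>card\<close>, and adding it up over disjoint
  pieces requires finite sets.\<close>

lemma finite_extreme_points_GZ: "finite {v. v extreme_point_of GZ p}"
proof -
  have "{v. v extreme_point_of GZ p} \<subseteq>
      {f. \<forall>x. (x \<in> gz_index (length p) \<longrightarrow> f x \<in> of_int ` set p) \<and> (x \<notin> gz_index (length p) \<longrightarrow> f x = 0)}"
    using extreme_point_of_GZ_entry by (auto simp: extreme_point_of_def GZ_iff)
  then show ?thesis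
    by (rule finite_subset) (intro finite_set_of_finite_funs finite_gz_index; simp)
qed

section \<open>Faces cut out by a first row\<close>

text \<open>The candidates for the first row of a vertex. As a set it counts a row once, even if
  several choices of neighbours produce it.\<close>

definition gz_rows :: "int list \<Rightarrow> int list set" where
  "gz_rows p = {q. Suc (length q) = length p \<and> (\<forall>j<length q. q ! j = p ! j \<or> q ! j = p ! Suc j)}"

text \<open>Inserts \<open>q\<close> as first row and moves the rows of \<open>w\<close> one step
  down. Row \<open>0\<close> of an array lives in the partition, so the function gets the default
  \<open>0\<close> there.\<close>

definition gz_lift :: "int list \<Rightarrow> (nat \<times> nat \<Rightarrow> real) \<Rightarrow> nat \<times> nat \<Rightarrow> real" where
  "gz_lift q w = (\<lambda>(i, j). if i = 1 then (if 1 \<le> j \<and> j \<le> length q then of_int (q ! (j - 1)) else 0)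
                           else if i = 0 then 0 else w (i - 1, j))"

text \<open>This includes \<open>i = 0\<close>, where both sides read \<open>q\<close>; thus the
  inequalities of \<open>GZ q\<close> turn into those of \<open>GZ p\<close> one row further
  down.\<close>

lemma gz_entry_lift:
  "1 \<le> j \<Longrightarrow> j \<le> length q \<Longrightarrow> gz_entry p (gz_lift q w) (Suc i) j = gz_entry q w i j"
  by (auto simp: gz_entry_def gz_lift_def)

lemma gz_rows_between:
  assumes "sorted p" "q \<in> gz_rows p" "j < length q"
  shows "p ! j \<le> q ! j" "q ! j \<le> p ! Suc j"
proof -
  have "p ! j \<le> p ! Suc j" using assms by (intro sorted_nth_mono) (auto simp: gz_rows_def)
  then show "p ! j \<le> q ! j" "q ! j \<le> p ! Suc j" using assms by (auto simp: gz_rows_def)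
qed

text \<open>Only the inequalities between rows \<open>0\<close> and \<open>1\<close> are new, and
  \<open>gz_rows_between\<close> supplies them.\<close>

lemma gz_lift_in_GZ:
  assumes "sorted p" "q \<in> gz_rows p" "w \<in> GZ q"
  shows "gz_lift q w \<in> GZ p"
  unfolding GZ_iff
proof (intro conjI allI impI)
  have len: "length p = Suc (length q)" using assms(2) by (simp add: gz_rows_def)
  have z: "w (i, j) = 0" if "\<not> (1 \<le> i \<and> 1 \<le> j \<and> i + j \<le> length q)" for i j
    using assms(3) that by (simp add: GZ_iff gz_index_iff)
  fix x assume "x \<notin> gz_index (length p)"
  then show "gz_lift q w x = 0"
    using len by (cases x) (auto simp: gz_lift_def gz_index_iff intro!: z)
next
  have len: "length p = Suc (length q)" using assms(2) by (simp add: gz_rows_def)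
  fix i j assume ij: "1 \<le> j" "Suc i + j \<le> length p"
  show "gz_entry p (gz_lift q w) i j \<le> gz_lift q w (Suc i, j)"
  proof (cases i)
    case 0
    then show ?thesis
      using gz_rows_between(1)[OF assms(1,2), of "j - 1"] ij len by (simp add: gz_entry_def gz_lift_def)
  next
    case (Suc i')
    then show ?thesis
      using assms(3) ij len by (simp add: gz_entry_lift GZ_iff) (simp add: gz_lift_def)
  qed
  show "gz_lift q w (Suc i, j) \<le> gz_entry p (gz_lift q w) i (Suc j)"
  proof (cases i)
    case 0
    then show ?thesis
      using gz_rows_between(2)[OF assms(1,2), of "j - 1"] ij len by (simp add: gz_entry_def gz_lift_def)
  next
    case (Suc i')
    then show ?thesis
      using assms(3) ij len by (simp add: gz_entry_lift GZ_iff) (simp add: gz_lift_def)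
  qed
qed

text \<open>Deleting the known first row of \<open>u\<close> leaves an array below \<open>q\<close>.
  Together with \<open>gz_lift_in_GZ\<close> this identifies \<open>GZ q\<close> with a slice of
  \<open>GZ p\<close>.\<close>

lemma GZ_eq_lift:
  assumes "u \<in> GZ p" "length p = Suc (length q)"
    and row: "\<And>j. j < length q \<Longrightarrow> u (1, Suc j) = of_int (q ! j)"
  obtains w where "w \<in> GZ q" "u = gz_lift q w"
proof
  define w where "w = (\<lambda>(i, j). if i = 0 then 0 else u (Suc i, j))"
  have z: "u (i, j) = 0" if "\<not> (1 \<le> i \<and> 1 \<le> j \<and> i + j \<le> Suc (length q))" for i j
    using assms(1,2) that by (simp add: GZ_iff gz_index_iff)
  show eq: "u = gz_lift q w"
  proof
    fix x :: "nat \<times> nat"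
    obtain i j where x: "x = (i, j)" by force
    show "u x = gz_lift q w x"
      using row[of "j - 1"] z[of i j] by (auto simp: x gz_lift_def w_def)
  qed
  show "w \<in> GZ q"
    unfolding GZ_iff
  proof (intro conjI allI impI)
    fix x assume "x \<notin> gz_index (length q)"
    then show "w x = 0" using z by (cases x) (auto simp: w_def gz_index_iff)
  next
    fix i j assume ij: "1 \<le> j" "Suc i + j \<le> length q"
    have "gz_entry p u (Suc i) j \<le> u (Suc (Suc i), j)"
         "u (Suc (Suc i), j) \<le> gz_entry p u (Suc i) (Suc j)"
      using assms(1,2) ij by (auto simp: GZ_iff)
    moreover have "gz_entry p u (Suc i) j = gz_entry q w i j"
      "gz_entry p u (Suc i) (Suc j) = gz_entry q w i (Suc j)"
      using ij by (auto simp: eq intro!: gz_entry_lift)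
    moreover have "w (Suc i, j) = u (Suc (Suc i), j)" by (simp add: w_def)
    ultimately show "gz_entry q w i j \<le> w (Suc i, j)" "w (Suc i, j) \<le> gz_entry q w i (Suc j)"
      by simp_all
  qed
qed

text \<open>The lift forgets the values of \<open>w\<close> at \<open>i = 0\<close>, hence the
  restriction to \<open>GZ q\<close>, where they vanish.\<close>

lemma inj_on_gz_lift: "inj_on (gz_lift q) (GZ q)"
proof (rule inj_onI)
  fix v w assume v: "v \<in> GZ q" and w: "w \<in> GZ q" and eq: "gz_lift q v = gz_lift q w"
  show "v = w"
  proof
    fix x :: "nat \<times> nat"
    obtain i j where x: "x = (i, j)" by force
    show "v x = w x"
    proof (cases i)
      case 0
      then show ?thesis using v w x by (simp add: GZ_iff gz_index_iff)
    next
      case (Suc i')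
      then show ?thesis using fun_cong[OF eq, of "(Suc i, j)"] x by (simp add: gz_lift_def)
    qed
  qed
qed

text \<open>The lift is affine rather than linear: the constant row \<open>q\<close> survives
  because the coefficients sum to one.\<close>

lemma gz_lift_convex:
  "gz_lift q ((1 - t) *\<^sub>R a + t *\<^sub>R b) = (1 - t) *\<^sub>R gz_lift q a + t *\<^sub>R gz_lift q b"
  by (auto simp: gz_lift_def scaleR_fun_def fun_eq_iff algebra_simps)

text \<open>An injective affine map preserves open segments; injectivity keeps the two ends
  distinct.\<close>

lemma gz_lift_open_segment:
  assumes "a \<in> GZ q" "b \<in> GZ q" "w \<in> GZ q"
  shows "gz_lift q w \<in> open_segment (gz_lift q a) (gz_lift q b) \<longleftrightarrow> w \<in> open_segment a b"
proof
  assume "w \<in> open_segment a b"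
  then obtain t where "a \<noteq> b" "0 < t" "t < 1" "w = (1 - t) *\<^sub>R a + t *\<^sub>R b"
    by (auto simp: in_segment)
  then show "gz_lift q w \<in> open_segment (gz_lift q a) (gz_lift q b)"
    using inj_onD[OF inj_on_gz_lift _ assms(1,2)] unfolding in_segment by (auto simp: gz_lift_convex)
next
  assume "gz_lift q w \<in> open_segment (gz_lift q a) (gz_lift q b)"
  then obtain t where t: "gz_lift q a \<noteq> gz_lift q b" "0 < t" "t < 1"
    "gz_lift q w = (1 - t) *\<^sub>R gz_lift q a + t *\<^sub>R gz_lift q b"
    by (auto simp: in_segment)
  have "w = (1 - t) *\<^sub>R a + t *\<^sub>R b"
  proof
    fix x :: "nat \<times> nat"
    obtain i j where x: "x = (i, j)" by force
    show "w x = ((1 - t) *\<^sub>R a + t *\<^sub>R b) x"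
    proof (cases i)
      case 0
      then show ?thesis using assms x by (simp add: GZ_iff gz_index_iff scaleR_fun_def)
    next
      case (Suc i')
      then show ?thesis
        using fun_cong[OF t(4), of "(Suc i, j)"] x by (simp add: gz_lift_def scaleR_fun_def)
    qed
  qed
  then show "w \<in> open_segment a b" using t(1-3) unfolding in_segment by auto
qed

text \<open>An endpoint of an interval is extreme in it. This forces the ends of a segment through a
  lifted vertex to share its first row.\<close>

lemma convex_comb_endpoint:
  fixes a b t c d :: real
  assumes "0 < t" "t < 1" "c \<le> a" "a \<le> d" "c \<le> b" "b \<le> d"
    and "z = (1 - t) * a + t * b" "z = c \<or> z = d"
  shows "a = z" "b = z"
proof -
  have "a = z \<and> b = z"
    using assms(8)
  proof
    assume "z = c"
    then have "(1 - t) * (a - c) + t * (b - c) = 0" using assms(7) by (simp add: algebra_simps)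
    moreover have "(1 - t) * (a - c) \<ge> 0" "t * (b - c) \<ge> 0" using assms by simp_all
    ultimately have "(1 - t) * (a - c) = 0" "t * (b - c) = 0" by linarith+
    then show ?thesis using assms(1,2) \<open>z = c\<close> by simp
  next
    assume "z = d"
    then have "(1 - t) * (d - a) + t * (d - b) = 0" using assms(7) by (simp add: algebra_simps)
    moreover have "(1 - t) * (d - a) \<ge> 0" "t * (d - b) \<ge> 0" using assms by simp_all
    ultimately have "(1 - t) * (d - a) = 0" "t * (d - b) = 0" by linarith+
    then show ?thesis using assms(1,2) \<open>z = d\<close> by simp
  qed
  then show "a = z" "b = z" by simp_all
qed

lemma extreme_points_GZ:
  assumes "sorted p" "p \<noteq> []"
  shows "{v. v extreme_point_of GZ p} = (\<Union>q \<in> gz_rows p. gz_lift q ` {w. w extreme_point_of GZ q})"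
proof (intro equalityI subsetI)
  fix u assume "u \<in> {v. v extreme_point_of GZ p}"
  then have u: "u extreme_point_of GZ p" by simp
  then have uG: "u \<in> GZ p" by (simp add: extreme_point_of_def)
  \<comment> \<open>The floor only converts type: the entries turn out to be parts of
    \<open>p\<close>, hence integers.\<close>
  define q where "q = map (\<lambda>j. \<lfloor>u (1, Suc j)\<rfloor>) [0..<length p - 1]"
  have len: "length p = Suc (length q)" using assms(2) by (simp add: q_def)
  have row: "u (1, Suc j) = of_int (q ! j) \<and> (q ! j = p ! j \<or> q ! j = p ! Suc j)"
    if j: "j < length q" for j
  proof -
    have "u (1, Suc j) \<in> of_int ` set p"
      using j len by (intro extreme_point_of_GZ_entry[OF u]) (simp add: gz_index_iff)
    then obtain i where i: "u (1, Suc j) = of_int (p ! i)" "i < length p"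
      by (auto simp: in_set_conv_nth)
    have "gz_entry p u 0 (Suc j) \<le> u (Suc 0, Suc j)" "u (Suc 0, Suc j) \<le> gz_entry p u 0 (Suc (Suc j))"
      using uG j len by (auto simp: GZ_iff)
    then have le: "p ! j \<le> p ! i" "p ! i \<le> p ! Suc j" using i by (auto simp: gz_entry_def)
    \<comment> \<open>As \<open>p\<close> is sorted, no part lies strictly between two consecutive
      ones.\<close>
    have "p ! i = p ! j \<or> p ! i = p ! Suc j"
    proof (cases "i \<le> j")
      case True
      then have "p ! i \<le> p ! j" using j len assms(1) by (intro sorted_nth_mono) auto
      then show ?thesis using le by simp
    next
      case False
      then have "p ! Suc j \<le> p ! i" using i assms(1) by (intro sorted_nth_mono) auto
      then show ?thesis using le by simp
    qed
    moreover have "q ! j = p ! i" using j i by (simp add: q_def)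
    ultimately show ?thesis using i by simp
  qed
  then have q: "q \<in> gz_rows p" using len by (simp add: gz_rows_def)
  obtain w where w: "w \<in> GZ q" "u = gz_lift q w"
    using GZ_eq_lift[OF uG len] row by blast
  \<comment> \<open>A segment in \<open>GZ q\<close> through \<open>w\<close> would lift to one in
    \<open>GZ p\<close> through \<open>u\<close>.\<close>
  have "w extreme_point_of GZ q"
    using u w gz_lift_in_GZ[OF assms(1) q] gz_lift_open_segment[OF _ _ w(1)]
    unfolding extreme_point_of_def by metis
  then show "u \<in> (\<Union>q \<in> gz_rows p. gz_lift q ` {w. w extreme_point_of GZ q})" using q w by auto
next
  fix u assume "u \<in> (\<Union>q \<in> gz_rows p. gz_lift q ` {w. w extreme_point_of GZ q})"
  then obtain q w where q: "q \<in> gz_rows p" and w: "w extreme_point_of GZ q" and u: "u = gz_lift q w"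
    by auto
  have wG: "w \<in> GZ q" using w by (simp add: extreme_point_of_def)
  have len: "length p = Suc (length q)" using q by (simp add: gz_rows_def)
  have "u \<notin> open_segment a b" if ab: "a \<in> GZ p" "b \<in> GZ p" for a b
  proof
    assume seg: "u \<in> open_segment a b"
    then obtain t where t: "0 < t" "t < 1" "u = (1 - t) *\<^sub>R a + t *\<^sub>R b"
      by (auto simp: in_segment)
    \<comment> \<open>Each first-row entry of \<open>u\<close> is an end of the interval allowed for
      \<open>a\<close> and \<open>b\<close>, so the whole segment lies in the slice over
      \<open>q\<close>.\<close>
    have row: "a (1, Suc j) = of_int (q ! j) \<and> b (1, Suc j) = of_int (q ! j)" if j: "j < length q" for j
    proof -
      have uq: "u (1, Suc j) = of_int (q ! j)" using j by (simp add: u gz_lift_def)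
      have bnd: "of_int (p ! j) \<le> v (1, Suc j) \<and> v (1, Suc j) \<le> of_int (p ! Suc j)"
        if "v \<in> GZ p" for v
      proof -
        have "gz_entry p v 0 (Suc j) \<le> v (Suc 0, Suc j)" "v (Suc 0, Suc j) \<le> gz_entry p v 0 (Suc (Suc j))"
          using that j len by (auto simp: GZ_iff)
        then show ?thesis by (simp add: gz_entry_def)
      qed
      have "real_of_int (q ! j) = (1 - t) * a (1, Suc j) + t * b (1, Suc j)"
        using fun_cong[OF t(3), of "(1, Suc j)"] uq by (simp add: scaleR_fun_def)
      moreover have "real_of_int (q ! j) = of_int (p ! j) \<or> real_of_int (q ! j) = of_int (p ! Suc j)"
        using q j by (auto simp: gz_rows_def)
      ultimately show ?thesis
        using convex_comb_endpoint[OF t(1,2)] bnd[OF ab(1)] bnd[OF ab(2)] by blast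
    qed
    obtain a' where a': "a' \<in> GZ q" "a = gz_lift q a'"
      using GZ_eq_lift[OF ab(1) len] row by blast
    obtain b' where b': "b' \<in> GZ q" "b = gz_lift q b'"
      using GZ_eq_lift[OF ab(2) len] row by blast
    have "w \<in> open_segment a' b'"
      using seg gz_lift_open_segment[OF a'(1) b'(1) wG] a' b' u by simp
    then show False using w a' b' by (auto simp: extreme_point_of_def)
  qed
  then show "u \<in> {v. v extreme_point_of GZ p}"
    using gz_lift_in_GZ[OF assms(1) q wG] u by (auto simp: extreme_point_of_def)
qed

section \<open>Counting vertices by their first row\<close>

lemma finite_gz_rows: "finite (gz_rows p)"
proof (rule finite_subset)
  show "gz_rows p \<subseteq> {q. set q \<subseteq> set p \<and> length q = length p - 1}"
    unfolding gz_rows_def by (auto simp: in_set_conv_nth) (metis Suc_less_eq less_SucI)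
qed (simp add: finite_lists_length_eq)

lemma num_vertices_rec:
  assumes "sorted p" "p \<noteq> []"
  shows "num_vertices p = (\<Sum>q \<in> gz_rows p. num_vertices q)"
proof -
  \<comment> \<open>The row \<open>q\<close> can be read off from any lift over \<open>q\<close>, so
    different rows give disjoint images.\<close>
  have disj: "gz_lift q ` A \<inter> gz_lift q' ` B = {}"
    if q: "q \<in> gz_rows p" "q' \<in> gz_rows p" "q \<noteq> q'" for q q' A B
  proof -
    have "length q = length q'" using q by (auto simp: gz_rows_def)
    then obtain j where j: "j < length q" "q ! j \<noteq> q' ! j" using q(3) nth_equalityI[of q q'] by blast
    have "gz_lift q a (1, Suc j) \<noteq> gz_lift q' b (1, Suc j)" for a b
      using j \<open>length q = length q'\<close> by (simp add: gz_lift_def)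
    then show ?thesis by (metis disjoint_iff imageE)
  qed
  have "num_vertices p = (\<Sum>q \<in> gz_rows p. card (gz_lift q ` {w. w extreme_point_of GZ q}))"
    unfolding num_vertices_def extreme_points_GZ[OF assms]
    using disj by (intro card_UN_disjoint ballI finite_gz_rows finite_imageI finite_extreme_points_GZ) auto
  also have "\<dots> = (\<Sum>q \<in> gz_rows p. num_vertices q)"
    unfolding num_vertices_def
    by (intro sum.cong refl card_image inj_on_subset[OF inj_on_gz_lift]) (auto simp: extreme_point_of_def)
  finally show ?thesis .
qed

lemma num_vertices_Nil: "num_vertices [] = 1"
proof -
  have "gz_index 0 = {}" by (auto simp: gz_index_def)
  then have "GZ [] = {0}" by (auto simp: GZ_def fun_eq_iff)
  then show ?thesis by (simp add: num_vertices_def extreme_point_of_def)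
qed

section \<open>First rows and vertex counts for one, two and three values\<close>

lemma gz_rows_singleton: "gz_rows [x] = {[]}"
  by (auto simp: gz_rows_def)

text \<open>The entries of a row are chosen independently of each other.\<close>

lemma gz_rows_Cons: "gz_rows (x # y # zs) = (\<Union>c \<in> {x, y}. (#) c ` gz_rows (y # zs))"
proof (intro set_eqI iffI)
  fix q assume "q \<in> gz_rows (x # y # zs)"
  then show "q \<in> (\<Union>c \<in> {x, y}. (#) c ` gz_rows (y # zs))"
    by (cases q) (auto simp: gz_rows_def All_less_Suc2)
next
  fix q assume "q \<in> (\<Union>c \<in> {x, y}. (#) c ` gz_rows (y # zs))"
  then obtain c q' where q: "q = c # q'" "c = x \<or> c = y" "q' \<in> gz_rows (y # zs)" by auto
  then have "length (y # zs) = Suc (length q')" by (simp add: gz_rows_def)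
  then show "q \<in> gz_rows (x # y # zs)" using q by (simp add: gz_rows_def All_less_Suc2)
qed

lemma gz_rows_replicate: "gz_rows (replicate (Suc k) x) = {replicate k x}"
  by (induction k) (simp_all add: gz_rows_singleton gz_rows_Cons)

text \<open>Inside a block of equal parts there is no choice; the first choice occurs at the
  boundary to the next value.\<close>

lemma gz_rows_replicate_append:
  "gz_rows (replicate (Suc k) x @ y # zs) =
     (\<Union>c \<in> {x, y}. (\<lambda>q. replicate k x @ c # q) ` gz_rows (y # zs))"
proof (induction k)
  case 0
  then show ?case by (simp add: gz_rows_Cons)
next
  case (Suc k)
  have "gz_rows (replicate (Suc (Suc k)) x @ y # zs) = (#) x ` gz_rows (replicate (Suc k) x @ y # zs)"
    by (simp add: gz_rows_Cons)
  then show ?case unfolding Suc by (auto simp: image_iff)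
qed

lemma num_vertices_replicate: "num_vertices (replicate k x) = 1"
  by (induction k) (simp_all only: replicate_0 num_vertices_Nil, subst num_vertices_rec,
      simp_all add: gz_rows_replicate del: replicate_Suc)

lemma sorted_replicate2: "x \<le> y \<Longrightarrow> sorted (replicate a x @ replicate b (y :: int))"
  by (auto simp: sorted_append)

lemma count_list_replicate: "count_list (replicate n x) y = (if x = y then n else 0)"
  by (induction n) auto

text \<open>The single boundary entry is \<open>x\<close> or \<open>y\<close>, so one copy of the
  other value is lost: this is Pascal's rule.\<close>

lemma num_vertices_two_valued:
  assumes "x < y"
  shows "num_vertices (replicate a x @ replicate b y) = (a + b) choose a"
proof (induction "a + b" arbitrary: a b)
  case 0
  then show ?case by (simp add: num_vertices_Nil)
next
  case (Suc n)
  show ?case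
  proof (cases "a = 0 \<or> b = 0")
    case True
    then show ?thesis by (auto simp: num_vertices_replicate)
  next
    case False
    then obtain a' b' where ab: "a = Suc a'" "b = Suc b'" by (metis not0_implies_Suc)
    have rows: "gz_rows (replicate a x @ replicate b y) =
        {replicate a x @ replicate b' y, replicate a' x @ replicate b y}"
      using gz_rows_replicate_append[of a' x y "replicate b' y"] gz_rows_replicate[of b' y]
      by (auto simp: ab replicate_app_Cons_same simp flip: replicate_Suc)
    have "count_list (replicate a x @ replicate b' y) x \<noteq> count_list (replicate a' x @ replicate b y) x"
      using assms by (simp add: ab count_list_replicate)
    then have ne: "replicate a x @ replicate b' y \<noteq> replicate a' x @ replicate b y" by metis
    have "num_vertices (replicate a x @ replicate b y) =
        num_vertices (replicate a x @ replicate b' y) + num_vertices (replicate a' x @ replicate b y)"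
      using num_vertices_rec[of "replicate a x @ replicate b y"] assms ne
      unfolding rows by (simp add: sorted_replicate2) (simp add: ab)
    also have "\<dots> = (a + b' choose a) + (a' + b choose a')"
      using Suc.hyps(1)[of a b'] Suc.hyps(1)[of a' b] Suc.hyps(2) by (simp add: ab)
    finally show ?thesis by (simp add: ab)
  qed
qed

text \<open>Two boundary entries, one from \<open>{1, 2}\<close> and one from \<open>{2, 3}\<close>,
  are chosen independently around \<open>l\<close> twos. With no twos at all there would be a single
  boundary, between 1 and 3.\<close>

lemma num_vertices_partition123_rec:
  "num_vertices (partition123 (Suc k) (Suc l) (Suc m)) =
     num_vertices (partition123 (Suc k) (Suc l) m) + num_vertices (partition123 (Suc k) l (Suc m)) +
     num_vertices (partition123 k (Suc (Suc l)) m) + num_vertices (partition123 k (Suc l) (Suc m))"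
proof -
  have srt: "sorted (partition123 a b c)" for a b c
    by (auto simp: partition123_def sorted_append)
  \<comment> \<open>The multiplicities determine the partition, so the four rows are distinct and
    contribute four separate summands.\<close>
  have ne: "partition123 a b c \<noteq> partition123 a' b' c'" if "a \<noteq> a' \<or> b \<noteq> b' \<or> c \<noteq> c'" for a b c a' b' c'
  proof -
    have "count_list (partition123 a b c) 1 = a" "count_list (partition123 a b c) 2 = b"
      "count_list (partition123 a b c) 3 = c" for a b c by (simp_all add: partition123_def count_list_replicate)
    then show ?thesis using that by metis
  qed
  have r3: "gz_rows (3 # replicate m 3) = {replicate m 3}"
    using gz_rows_replicate[of m 3] by simp
  have r2: "gz_rows (2 # replicate l 2 @ 3 # replicate m 3) =
      {replicate l 2 @ 2 # replicate m 3, replicate l 2 @ 3 # replicate m 3}"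
    using gz_rows_replicate_append[of l 2 3 "replicate m 3"] by (auto simp: r3)
  have "gz_rows (partition123 (Suc k) (Suc l) (Suc m)) =
      {partition123 (Suc k) (Suc l) m, partition123 (Suc k) l (Suc m),
       partition123 k (Suc (Suc l)) m, partition123 k (Suc l) (Suc m)}"
    using gz_rows_replicate_append[of k 1 2 "replicate l 2 @ 3 # replicate m 3"]
    by (auto simp: partition123_def r2 replicate_app_Cons_same)
  moreover have "partition123 (Suc k) (Suc l) (Suc m) \<noteq> []" by (simp add: partition123_def)
  ultimately show ?thesis by (simp add: num_vertices_rec[OF srt] ne)
qed

section \<open>The alternating binomial sum and its recurrence\<close>

text \<open>
  The upper limit is a parameter because the recurrence changes \<open>k\<close>; it is irrelevant once \<open>N \<ge> k\<close>.
\<close>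

definition vertex_sum :: "nat \<Rightarrow> nat \<Rightarrow> int \<Rightarrow> int \<Rightarrow> int" where
  "vertex_sum N s k m = zbinomial s k * zbinomial s m +
     2 * (\<Sum>i = 1..N. (-1) ^ i * zbinomial s (k - int i) * zbinomial s (m - int i))"

text \<open>The zero convention makes Pascal's rule hold at every integer, including the boundary
  \<open>j = 0\<close>.\<close>

lemma zbinomial_Suc: "zbinomial (Suc s) j = zbinomial s j + zbinomial s (j - 1)"
proof (cases "j \<le> 0")
  case True
  then show ?thesis by (auto simp: zbinomial_def)
next
  case False
  then obtain i where "j = int (Suc i)" by (metis not0_implies_Suc nonneg_int_cases nle_le of_nat_0)
  then show ?thesis by (simp add: zbinomial_def nat_add_distrib)
qed

text \<open>Pascal's rule in both factors of each term; the common limit \<open>N\<close> allows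
  comparison term by term.\<close>

lemma vertex_sum_Suc:
  "vertex_sum N (Suc s) k m =
     vertex_sum N s k m + vertex_sum N s (k - 1) m + vertex_sum N s k (m - 1) + vertex_sum N s (k - 1) (m - 1)"
  by (simp add: vertex_sum_def zbinomial_Suc algebra_simps sum.distrib)

text \<open>
  Multiplication of the generating function by \<open>1 + x y\<close>. If \<open>k + m = s + 1\<close> then the right-hand side
  vanishes, which reduces the recurrence for \<open>l = 0\<close> to Pascal's rule.
\<close>

lemma vertex_sum_diag:
  "vertex_sum (Suc N) s k m + vertex_sum N s (k - 1) (m - 1) =
     zbinomial s k * zbinomial s m - zbinomial s (k - 1) * zbinomial s (m - 1)"
proof -
  define f where "f i = (-1) ^ i * zbinomial s (k - int i) * zbinomial s (m - int i)" for i
  have "sum f {1..Suc N} = f 1 + (\<Sum>i = 1..N. f (Suc i))"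
    using sum.atLeast_Suc_atMost[of 1 "Suc N" f] sum.shift_bounds_cl_Suc_ivl[of f 1 N] by simp
  also have "(\<Sum>i = 1..N. f (Suc i)) =
      - (\<Sum>i = 1..N. (-1) ^ i * zbinomial s (k - 1 - int i) * zbinomial s (m - 1 - int i))"
    by (simp add: f_def algebra_simps flip: sum_negf)
  finally have "(\<Sum>i = 1..Suc N. (-1) ^ i * zbinomial s (k - int i) * zbinomial s (m - int i)) =
      - (zbinomial s (k - 1) * zbinomial s (m - 1)) -
      (\<Sum>i = 1..N. (-1) ^ i * zbinomial s (k - 1 - int i) * zbinomial s (m - 1 - int i))"
    by (simp add: f_def)
  \<comment> \<open>The shifted sums cancel, and \<open>-2 + 1\<close> copies of the split-off
    product remain.\<close>
  then show ?thesis unfolding vertex_sum_def by linarith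
qed

text \<open>The additional term has the negative lower index \<open>k - int (Suc N)\<close>.\<close>

lemma vertex_sum_stable: "k \<le> int N \<Longrightarrow> vertex_sum (Suc N) s k m = vertex_sum N s k m"
  by (simp add: vertex_sum_def zbinomial_def)

lemma vertex_sum_0_left: "vertex_sum N s 0 (int m) = int (s choose m)"
  by (simp add: vertex_sum_def zbinomial_def)

lemma vertex_sum_0_right: "vertex_sum N s (int k) 0 = int (s choose k)"
  by (simp add: vertex_sum_def zbinomial_def)

text \<open>Of the four terms of \<open>vertex_sum_Suc\<close>, the first and the last cancel by
  \<open>vertex_sum_diag\<close>; the other two add up by Pascal's rule.\<close>

lemma vertex_sum_no_middle: "k \<le> N \<Longrightarrow> vertex_sum N (k + m) (int k) (int m) = int ((k + m) choose k)"
proof (induction "k + m" arbitrary: k m)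
  case 0
  then show ?case by (simp add: vertex_sum_def zbinomial_def)
next
  case (Suc s)
  show ?case
  proof (cases "k = 0 \<or> m = 0")
    case True
    then show ?thesis using vertex_sum_0_left[of N m m] vertex_sum_0_right[of N k k] by auto
  next
    case False
    then obtain k' m' where km: "k = Suc k'" "m = Suc m'" by (metis not0_implies_Suc)
    obtain N' where N: "N = Suc N'" using Suc.prems km by (cases N) auto
    have s: "s = k' + m" "s = k + m'" using Suc.hyps km by auto
    have 1: "vertex_sum N s (int k') (int m) = int (s choose k')"
      using Suc.hyps(1)[of k' m] Suc.prems s km by simp
    have 2: "vertex_sum N s (int k) (int m') = int (s choose k)"
      using Suc.hyps(1)[of k m'] Suc.prems s km by simp
    have "vertex_sum N s (int k) (int m) + vertex_sum N' s (int k') (int m') =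
        int (s choose k) * int (s choose m) - int (s choose k') * int (s choose m')"
      using vertex_sum_diag[of N' s "int k" "int m"] by (simp add: km N zbinomial_def nat_add_distrib)
    \<comment> \<open>Since \<open>k' + m = s = k + m'\<close>, symmetry of binomials makes the two
      products on the right equal.\<close>
    moreover have "s - k' = m" "s - k = m'" "k' \<le> s" "k \<le> s" using s by simp_all
    then have "s choose m = s choose k'" "s choose m' = s choose k"
      using binomial_symmetric[of k' s] binomial_symmetric[of k s] by simp_all
    \<comment> \<open>\<open>vertex_sum_diag\<close> lowers the limit by one; as
      \<open>k' \<le> N'\<close>, it can be raised again.\<close>
    moreover have "vertex_sum N s (int k') (int m') = vertex_sum N' s (int k') (int m')"
      unfolding N using Suc.prems km N by (intro vertex_sum_stable) simp
    ultimately have 3: "vertex_sum N s (int k) (int m) + vertex_sum N s (int k') (int m') = 0" by simp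
    have "vertex_sum N (Suc s) (int k) (int m) = int (s choose k') + int (s choose k)"
      using vertex_sum_Suc[of N s "int k" "int m"] 1 2 3 by (simp add: km)
    then show ?thesis using s by (simp add: km)
  qed
qed

section \<open>Matching the vertex count with the sum\<close>

text \<open>Induction on the number of parts, which drops by one in every row although the middle
  multiplicity may grow. If a value is missing, the two-valued count applies.\<close>

lemma num_vertices_partition123:
  "k \<le> N \<Longrightarrow> int (num_vertices (partition123 k l m)) = vertex_sum N (k + l + m) (int k) (int m)"
proof (induction "k + l + m" arbitrary: k l m)
  case 0
  then show ?case by (simp add: partition123_def num_vertices_Nil vertex_sum_def zbinomial_def)
next
  case (Suc s)
  consider "k = 0" | "m = 0" | "l = 0" | k' l' m' where "k = Suc k'" "l = Suc l'" "m = Suc m'"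
    by (metis not0_implies_Suc)
  then show ?case
  proof cases
    case 1
    then show ?thesis
      using num_vertices_two_valued[of 2 3 l m] vertex_sum_0_left[of N "l + m" m]
        binomial_symmetric[of m "l + m"] by (simp add: partition123_def)
  next
    case 2
    then show ?thesis
      using num_vertices_two_valued[of 1 2 k l] vertex_sum_0_right[of N "k + l" k]
      by (simp add: partition123_def)
  next
    case 3
    then show ?thesis
      using num_vertices_two_valued[of 1 3 k m] vertex_sum_no_middle[OF Suc.prems, of m]
      by (simp add: partition123_def)
  next
    case 4
    have "int (num_vertices (partition123 k l m)) =
        vertex_sum N s (int k) (int m') + vertex_sum N s (int k) (int m) +
        vertex_sum N s (int k') (int m') + vertex_sum N s (int k') (int m)"
      using Suc.hyps(1)[of k l m'] Suc.hyps(1)[of k l' m] Suc.hyps(1)[of k' "Suc l" m']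
        Suc.hyps(1)[of k' l m] Suc.hyps(2) Suc.prems
      by (simp add: 4 num_vertices_partition123_rec)
    then show ?thesis
      unfolding Suc.hyps(2)[symmetric] using vertex_sum_Suc[of N s "int k" "int m"] by (simp add: 4)
  qed
qed

theorem mainTheorem5:
  fixes k l m s :: nat
  assumes "k > 0" and "l > 0" and "m > 0"
    and "s = k + l + m"
  shows "int (num_vertices (partition123 k l m)) =
    zbinomial s (int k) * zbinomial s (int m) +
    2 * (\<Sum>i = 1..k. (-1) ^ i * zbinomial s (int k - int i) * zbinomial s (int m - int i))"
  using num_vertices_partition123[of k k l m] assms(4) by (simp add: vertex_sum_def)

end
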